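(* There is an algorithm (BuildFort) for a single robot modelled as a deterministic finite automaton which, starting at a full cell of any initial connected field in the infinite grid $\mathbb{Z}\times\mathbb{Z}$, correctly builds a fort.
   Context: The environment is the infinite oriented square grid $\mathbb{Z}\times\mathbb{Z}$ of cells; each cell has four neighbours (North, East, South, West). A cell containing a brick is full, otherwise empty. The field is the subgraph induced by the full cells; initially it is connected. Its size is the number $z$ of full cells and its span is the maximum Manhattan distance between two full cells. The robot is a deterministic finite (Mealy) automaton with bounded memory; it starts at a full cell, moves one cell per step in one of four directions, observes only whether its current cell is full (and, via bounded local exploration encoded in its finitely many states, cells within a constant distance), can pick a brick from a full cell and drop a brick into an empty cell, and carries at most one brick at a time. A fort is a hollow rectangle made of the bricks: bricks occupy exactly the perimeter cells of an axis-parallel rectangle; when the number of bricks is odd a rough fort is allowed, i.e. such a rectangle with one extra brick attached at one of its corners. (The algorithm exits immediately if the initial field has span at most 2.) *)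

theory Defs
  imports Main
begin

type_synonym cell = "int \<times> int"

datatype dir = North | East | South | West

fun neighbour :: "dir \<Rightarrow> cell \<Rightarrow> cell" where
  "neighbour North (x, y) = (x, y + 1)"
| "neighbour East (x, y) = (x + 1, y)"
| "neighbour South (x, y) = (x, y - 1)"
| "neighbour West (x, y) = (x - 1, y)"

definition adjacent :: "cell \<Rightarrow> cell \<Rightarrow> bool" where
  "adjacent p q \<longleftrightarrow> (\<exists>d. q = neighbour d p)"

definition manhattan :: "cell \<Rightarrow> cell \<Rightarrow> nat" where
  "manhattan p q = nat (\<bar>fst p - fst q\<bar> + \<bar>snd p - snd q\<bar>)"

definition grid_connected :: "cell set \<Rightarrow> bool" where
  "grid_connected F \<longleftrightarrow>
     (\<forall>p\<in>F. \<forall>q\<in>F. (p, q) \<in> {(u, v). u \<in> F \<and> v \<in> F \<and> adjacent u v}\<^sup>*)"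

definition field_span :: "cell set \<Rightarrow> nat" where
  "field_span F = Max {manhattan p q | p q. p \<in> F \<and> q \<in> F}"


datatype brick_op = Keep | Pick | Drop

text \<open>
  In \<open>next_state R q full loaded\<close> and \<open>emit R q full loaded\<close> the arguments \<open>full\<close> and
  \<open>loaded\<close> form the input letter: whether the current cell is full, and whether the robot
  carries a brick.  The output letter is an operation on the current cell, followed by a move.
\<close>

record robot =
  states :: "nat set"
  start_state :: nat
  final_states :: "nat set"
  next_state :: "nat \<Rightarrow> bool \<Rightarrow> bool \<Rightarrow> nat"
  emit :: "nat \<Rightarrow> bool \<Rightarrow> bool \<Rightarrow> brick_op \<times> dir"

definition finite_automaton :: "robot \<Rightarrow> bool" where
  "finite_automaton R \<longleftrightarrow>
     finite (states R) \<and> start_state R \<in> states R \<and> final_states R \<subseteq> states R \<and>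
     (\<forall>q\<in>states R. \<forall>full loaded.
        next_state R q full loaded \<in> states R \<and>
        (fst (emit R q full loaded) = Pick \<longrightarrow> full \<and> \<not> loaded) \<and>
        (fst (emit R q full loaded) = Drop \<longrightarrow> \<not> full \<and> loaded))"

record config =
  state :: nat
  position :: cell
  carrying :: bool
  bricks :: "cell set"

text \<open>
  A configuration in a final state is never left.  A carried brick does not belong to \<open>bricks\<close>.
\<close>

definition step :: "robot \<Rightarrow> config \<Rightarrow> config" where
  "step R c =
    (if state c \<in> final_states R then c
     else
       let full = (position c \<in> bricks c);
           (a, d) = emit R (state c) full (carrying c)
       in \<lparr>state = next_state R (state c) full (carrying c),
           position = neighbour d (position c),
           carrying = (case a of Keep \<Rightarrow> carrying c | Pick \<Rightarrow> True | Drop \<Rightarrow> False),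
           bricks = (case a of Keep \<Rightarrow> bricks c
                     | Pick \<Rightarrow> bricks c - {position c}
                     | Drop \<Rightarrow> insert (position c) (bricks c))\<rparr>)"

definition run :: "robot \<Rightarrow> cell set \<Rightarrow> cell \<Rightarrow> nat \<Rightarrow> config" where
  "run R F s t =
     (step R ^^ t) \<lparr>state = start_state R, position = s, carrying = False, bricks = F\<rparr>"


definition perimeter :: "int \<Rightarrow> int \<Rightarrow> int \<Rightarrow> int \<Rightarrow> cell set" where
  "perimeter x1 x2 y1 y2 =
     {(x, y). x1 \<le> x \<and> x \<le> x2 \<and> y1 \<le> y \<and> y \<le> y2 \<and>
              (x = x1 \<or> x = x2 \<or> y = y1 \<or> y = y2)}"

text \<open>
  A rectangle that encloses at least one cell has at least eight perimeter cells.  With eight or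
  more bricks the rectangle must therefore enclose a cell; with fewer this is impossible, and
  only both side lengths being at least two cells is required.
\<close>

definition admissible_rectangle :: "nat \<Rightarrow> int \<Rightarrow> int \<Rightarrow> int \<Rightarrow> int \<Rightarrow> bool" where
  "admissible_rectangle z x1 x2 y1 y2 \<longleftrightarrow>
     x1 < x2 \<and> y1 < y2 \<and> (8 \<le> z \<longrightarrow> x1 + 1 < x2 \<and> y1 + 1 < y2)"

definition smooth_fort :: "cell set \<Rightarrow> bool" where
  "smooth_fort B \<longleftrightarrow>
     (\<exists>x1 x2 y1 y2. admissible_rectangle (card B) x1 x2 y1 y2 \<and> B = perimeter x1 x2 y1 y2)"

text \<open>
  Both neighbours of a corner that are not on the perimeter lie outside the rectangle, so the
  extra brick is never inside.
\<close>

definition rough_fort :: "cell set \<Rightarrow> bool" where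
  "rough_fort B \<longleftrightarrow>
     (\<exists>x1 x2 y1 y2. admissible_rectangle (card B) x1 x2 y1 y2 \<and>
        (\<exists>corner\<in>{x1, x2} \<times> {y1, y2}. \<exists>e. adjacent corner e \<and> e \<notin> perimeter x1 x2 y1 y2 \<and>
           B = insert e (perimeter x1 x2 y1 y2)))"

definition fort :: "cell set \<Rightarrow> bool" where
  "fort B \<longleftrightarrow> (if even (card B) then smooth_fort B else rough_fort B)"

end

theory Submission
  imports Defs "HOL-Library.Countable"
begin

text \<open>
  The automaton first probes all cells within distance 3; by connectedness this decides whether the
  span is at most 2, and in that case it stops.  Otherwise it repeatedly looks for a maximal
  vertical segment without western neighbours.  If the segment has an eastern neighbour, its top
  brick at \<open>(x, y)\<close> is moved to the first empty cell below \<open>(x + 1, y)\<close> in the next column: this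
  keeps the field connected, increases the sum of the first coordinates and does not increase
  their maximum.  So eventually some segment has neither western nor eastern neighbours, and the
  field is a vertical line.

  The line is then folded into a rectangle of width 3: one brick goes to the middle of the
  bottom row, then bricks are carried one by one from the top of the left column to the top of the
  right column, until the left column exceeds the right one by 1 or 2; its top brick then
  closes the ring, and a remaining excess brick sits above a corner.  With 4 or 5 bricks the
  rectangle has width 2.
\<close>

section \<open>The automaton\<close>

text \<open>
  \<open>Probe bs\<close> remembers the fullness of the cells visited so far along a fixed closed tour; the flag
  of \<open>Scan\<close> and its companions records whether an eastern neighbour has been seen on the current
  segment; the list in \<open>Gauge\<close> and \<open>Close\<close> holds the moves still to be made before the automaton
  tests the height of the left column or drops the last brick, respectively.
\<close>

datatype control =
    Probe "bool list"
  | Rise | Scan bool | LookWest bool | Cross bool | LookEast bool | Return bool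
  | Climb | Lift | Shift | Sink
  | Stack | Unstack | Descend | Under | Base | Grow | Gauge "dir list"
  | Top | BelowTop | Close "dir list" | Done

instance dir :: countable
  by countable_datatype

instance control :: countable
  by countable_datatype

lemma UNIV_dir: "UNIV = {North, East, South, West}"
  using dir.exhaust by auto

instance dir :: finite
  by standard (simp add: UNIV_dir)

text \<open>A closed walk that sweeps, row by row in alternating directions, the square of cells
  whose coordinates are at most 3 in absolute value. Radius 3 suffices: a connected field that
  reaches farther from the start also has a cell at distance exactly 3.\<close>

definition tour :: "dir list" where
  "tour = replicate 3 South @ replicate 3 West @
     concat (replicate 3 (replicate 6 East @ North # replicate 6 West @ [North])) @
     replicate 6 East @ replicate 3 West @ replicate 3 South"

text \<open>The final cell is omitted: each reading is taken before a move, so cells and readings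
  line up one to one.\<close>

fun trace :: "cell \<Rightarrow> dir list \<Rightarrow> cell list" where
  "trace p [] = []"
| "trace p (d # ds) = p # trace (neighbour d p) ds"

text \<open>Positions are relative to the start cell, since the automaton knows no
  coordinates.\<close>

definition narrow :: "bool list \<Rightarrow> bool" where
  "narrow bs \<longleftrightarrow>
     (\<forall>(p, a)\<in>set (zip (trace (0, 0) tour) bs). \<forall>(q, b)\<in>set (zip (trace (0, 0) tour) bs).
        a \<and> b \<longrightarrow> manhattan p q \<le> 2)"

text \<open>\<open>finite_automaton\<close> demands legality for every input letter in every state,
  so the guard is built into the output, here and in \<open>drop_brick\<close>.\<close>

definition pick :: "bool \<Rightarrow> bool \<Rightarrow> brick_op" where
  "pick full loaded = (if full \<and> \<not> loaded then Pick else Keep)"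

definition drop_brick :: "bool \<Rightarrow> bool \<Rightarrow> brick_op" where
  "drop_brick full loaded = (if \<not> full \<and> loaded then Drop else Keep)"

fun delta :: "control \<Rightarrow> bool \<Rightarrow> bool \<Rightarrow> control \<times> brick_op \<times> dir" where
  "delta (Probe bs) f l =
     (let cs = bs @ [f] in
       if length cs < length tour then Probe cs else if narrow cs then Done else Rise,
      Keep, tour ! length bs)"
| "delta Rise f l = (if f then (Rise, Keep, North) else (Scan False, Keep, South))"
| "delta (Scan e) f l =
     (if f then (LookWest e, Keep, West) else (if e then Climb else Stack, Keep, North))"
| "delta (LookWest e) f l = (if f then (Rise, Keep, North) else (Cross e, Keep, East))"
| "delta (Cross e) f l = (LookEast e, Keep, East)"
| "delta (LookEast e) f l = (Return (e \<or> f), Keep, West)"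
| "delta (Return e) f l = (Scan e, Keep, South)"
| "delta Climb f l = (if f then (Climb, Keep, North) else (Lift, Keep, South))"
| "delta Lift f l = (Shift, pick f l, East)"
| "delta Shift f l = (Sink, Keep, South)"
| "delta Sink f l = (if f then (Sink, Keep, South) else (Rise, drop_brick f l, North))"
| "delta Stack f l = (if f then (Stack, Keep, North) else (Unstack, Keep, South))"
| "delta Unstack f l = (Descend, pick f l, South)"
| "delta Descend f l = (if f then (Descend, Keep, South) else (Under, Keep, East))"
| "delta Under f l = (Base, Keep, North)"
| "delta Base f l =
     (if f then (Grow, Keep, East) else (Gauge [North, North, North, West], drop_brick f l, North))"
| "delta Grow f l =
     (if f then (Grow, Keep, North) else (Gauge [North, North, West, West], drop_brick f l, North))"
| "delta (Gauge (d # ds)) f l = (Gauge ds, Keep, d)"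
| "delta (Gauge []) f l = (if f then (Stack, Keep, North) else (Top, Keep, South))"
| "delta Top f l = (if f then (Close [South, East], pick f l, South) else (BelowTop, Keep, South))"
| "delta BelowTop f l = (Close [East], pick f l, South)"
| "delta (Close (d # ds)) f l = (Close ds, Keep, d)"
| "delta (Close []) f l = (Done, drop_brick f l, North)"
| "delta Done f l = (Done, Keep, North)"

text \<open>The bounds 4 and 2 are the lengths of the longest lists with which \<open>Gauge\<close>
  and \<open>Close\<close> are entered; afterwards the lists only shrink.\<close>

definition controls :: "control set" where
  "controls = Probe ` {bs. length bs < length tour} \<union>
     {Rise, Climb, Lift, Shift, Sink, Stack, Unstack, Descend, Under, Base, Grow, Top, BelowTop, Done}
     \<union> Scan ` UNIV \<union> LookWest ` UNIV \<union> Cross ` UNIV \<union> LookEast ` UNIV \<union> Return ` UNIV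
     \<union> Gauge ` {ds. length ds \<le> 4} \<union> Close ` {ds. length ds \<le> 2}"

definition builder :: robot where
  "builder = \<lparr>states = to_nat ` controls, start_state = to_nat (Probe []),
     final_states = {to_nat Done},
     next_state = \<lambda>q f l. to_nat (fst (delta (from_nat q) f l)),
     emit = \<lambda>q f l. snd (delta (from_nat q) f l)\<rparr>"

section \<open>Finiteness and legality\<close>

lemma delta_in_controls:
  assumes "q \<in> controls"
  shows "fst (delta q f l) \<in> controls"
  using assms unfolding controls_def
  by (cases "(q, f, l)" rule: delta.cases) (auto simp: Let_def)

lemma finite_controls: "finite controls"
proof -
  have "finite {bs :: bool list. length bs < length tour}"
    by (rule finite_subset[OF _ finite_lists_length_le[of UNIV "length tour"]]) auto
  moreover have "finite {ds :: dir list. length ds \<le> n}" for n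
    using finite_lists_length_le[of "UNIV :: dir set" n] by simp
  ultimately show ?thesis
    by (simp add: controls_def)
qed

lemma tour_nonempty: "0 < length tour"
  by (simp add: tour_def)

lemma delta_legal:
  "fst (snd (delta q f l)) = Pick \<Longrightarrow> f \<and> \<not> l"
  "fst (snd (delta q f l)) = Drop \<Longrightarrow> \<not> f \<and> l"
  by (cases "(q, f, l)" rule: delta.cases;
      auto simp: pick_def drop_brick_def split: if_splits)+

lemma finite_automaton_builder: "finite_automaton builder"
proof -
  have "Probe [] \<in> controls" "Done \<in> controls"
    using tour_nonempty by (auto simp: controls_def)
  then show ?thesis
    unfolding finite_automaton_def builder_def
    by (auto simp: finite_controls delta_in_controls dest: delta_legal)
qed

section \<open>Symbolic execution and reachability\<close>

definition cfg :: "control \<Rightarrow> cell \<Rightarrow> bool \<Rightarrow> cell set \<Rightarrow> config" where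
  "cfg q p l B = \<lparr>state = to_nat q, position = p, carrying = l, bricks = B\<rparr>"

text \<open>Hides the coding of controls by numbers; as a simp rule it executes any fixed number of
  steps.\<close>

lemma step_cfg [simp]:
  "step builder (cfg q p l B) =
     (if q = Done then cfg q p l B
      else case delta q (p \<in> B) l of (r, a, d) \<Rightarrow>
        cfg r (neighbour d p) (case a of Keep \<Rightarrow> l | Pick \<Rightarrow> True | Drop \<Rightarrow> False)
          (case a of Keep \<Rightarrow> B | Pick \<Rightarrow> B - {p} | Drop \<Rightarrow> insert p B))"
  by (simp add: step_def cfg_def builder_def Let_def split: prod.split brick_op.split)

definition leads :: "config \<Rightarrow> config \<Rightarrow> bool" where
  "leads c c' \<longleftrightarrow> (\<exists>t. (step builder ^^ t) c = c')"

lemma leads_funpow: "(step builder ^^ t) c = c' \<Longrightarrow> leads c c'"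
  by (auto simp: leads_def)

lemma leads_refl [simp]: "leads c c"
  by (rule leads_funpow[of 0]) simp

lemma leads_trans [trans]: "leads a b \<Longrightarrow> leads b c \<Longrightarrow> leads a c"
  unfolding leads_def by (metis comp_apply funpow_add)

text \<open>Covers all loops that climb while the cell is full. The range is half-open, so nothing
  is assumed about the cell \<open>(x, b)\<close> where the walk is cut off.\<close>

lemma leads_north:
  assumes "delta q True l = (q, Keep, North)" "q \<noteq> Done"
  shows "a \<le> b \<Longrightarrow> \<forall>i\<in>{a..<b}. (x, i) \<in> B \<Longrightarrow> leads (cfg q (x, a) l B) (cfg q (x, b) l B)"
proof (induction b rule: int_ge_induct)
  case (step i)
  have "leads (cfg q (x, a) l B) (cfg q (x, i) l B)"
    using step by simp
  also have "leads \<dots> (cfg q (x, i + 1) l B)"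
    using assms step by (intro leads_funpow[of 1]) simp
  finally show ?case .
qed simp

lemma leads_south:
  assumes "delta q True l = (q, Keep, South)" "q \<noteq> Done"
  shows "b \<le> a \<Longrightarrow> \<forall>i\<in>{b<..a}. (x, i) \<in> B \<Longrightarrow> leads (cfg q (x, a) l B) (cfg q (x, b) l B)"
proof (induction b rule: int_le_induct)
  case (step i)
  have "leads (cfg q (x, a) l B) (cfg q (x, i) l B)"
    using step by simp
  also have "leads \<dots> (cfg q (x, i - 1) l B)"
    using assms step by (intro leads_funpow[of 1]) simp
  finally show ?case .
qed simp

text \<open>A finite field cannot contain a whole vertical ray.\<close>

lemma first_empty_above:
  fixes B :: "cell set"
  assumes "finite B"
  obtains t where "y \<le> t" "\<forall>i\<in>{y..<t}. (x, i) \<in> B" "(x, t) \<notin> B"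
proof -
  have "infinite (range (\<lambda>k. (x, y + int k)))"
    by (simp add: finite_image_iff inj_def)
  then have "\<not> range (\<lambda>k. (x, y + int k)) \<subseteq> B"
    using assms finite_subset by blast
  then have "\<exists>k. (x, y + int k) \<notin> B"
    by auto
  then obtain k where k: "(x, y + int k) \<notin> B" "\<And>i. i < k \<Longrightarrow> (x, y + int i) \<in> B"
    using exists_least_iff[of "\<lambda>k. (x, y + int k) \<notin> B"] by auto
  have "(x, i) \<in> B" if "i \<in> {y..<y + int k}" for i
    using k(2)[of "nat (i - y)"] that by auto
  with k(1) show ?thesis
    by (intro that[of "y + int k"]) auto
qed

lemma first_empty_below:
  fixes B :: "cell set"
  assumes "finite B"
  obtains t where "t \<le> y" "\<forall>i\<in>{t<..y}. (x, i) \<in> B" "(x, t) \<notin> B"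
proof -
  have "infinite (range (\<lambda>k. (x, y - int k)))"
    by (simp add: finite_image_iff inj_def)
  then have "\<not> range (\<lambda>k. (x, y - int k)) \<subseteq> B"
    using assms finite_subset by blast
  then have "\<exists>k. (x, y - int k) \<notin> B"
    by auto
  then obtain k where k: "(x, y - int k) \<notin> B" "\<And>i. i < k \<Longrightarrow> (x, y - int i) \<in> B"
    using exists_least_iff[of "\<lambda>k. (x, y - int k) \<notin> B"] by auto
  have "(x, i) \<in> B" if "i \<in> {y - int k<..y}" for i
    using k(2)[of "nat (y - i)"] that by auto
  with k(1) show ?thesis
    by (intro that[of "y - int k"]) auto
qed

section \<open>Connected fields\<close>

abbreviation links :: "cell set \<Rightarrow> (cell \<times> cell) set" where
  "links B \<equiv> {(u, v). u \<in> B \<and> v \<in> B \<and> adjacent u v}"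

lemma adjacent_iff:
  "adjacent (x, y) (u, v) \<longleftrightarrow>
     u = x \<and> (v = y + 1 \<or> v = y - 1) \<or> v = y \<and> (u = x + 1 \<or> u = x - 1)"
proof -
  have "adjacent (x, y) (u, v) \<longleftrightarrow> (\<exists>d\<in>{North, East, South, West}. (u, v) = neighbour d (x, y))"
    by (simp add: adjacent_def flip: UNIV_dir)
  then show ?thesis by auto
qed

lemma adjacent_sym: "adjacent p q \<Longrightarrow> adjacent q p"
  by (cases p; cases q) (auto simp: adjacent_iff)

lemma connected_closed:
  assumes "grid_connected B" "p \<in> B" "p \<in> A"
    and closed: "\<And>u v. u \<in> A \<Longrightarrow> v \<in> B \<Longrightarrow> adjacent u v \<Longrightarrow> v \<in> A"
  shows "B \<subseteq> A"
proof
  fix q assume "q \<in> B"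
  then have "(p, q) \<in> (links B)\<^sup>*"
    using assms(1,2) by (auto simp: grid_connected_def)
  then show "q \<in> A"
    by (induction rule: rtrancl_induct) (use assms(3) closed in auto)
qed

lemma links_rtrancl_sym: "(p, q) \<in> (links B)\<^sup>* \<Longrightarrow> (q, p) \<in> (links B)\<^sup>*"
  by (rule symD[OF sym_rtrancl]) (auto simp: sym_def intro: adjacent_sym)

lemma connected_if_all_linked:
  assumes "\<And>p. p \<in> B \<Longrightarrow> (p, n) \<in> (links B)\<^sup>*"
  shows "grid_connected B"
  unfolding grid_connected_def
  using rtrancl_trans[OF assms links_rtrancl_sym[OF assms]] by blast

text \<open>A path from \<open>p\<close> to \<open>t\<close> stays within the remaining bricks until
  it first meets \<open>t\<close>, so it reaches a neighbour of \<open>t\<close>; from there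
  \<open>nb\<close> leads on to \<open>n\<close>. Hence every brick is linked to
  \<open>n\<close>.\<close>

lemma connected_move_brick:
  assumes conn: "grid_connected B" and t: "t \<in> B"
    and nb: "\<And>p. p \<in> B \<Longrightarrow> p \<noteq> t \<Longrightarrow> adjacent p t \<Longrightarrow> (p, n) \<in> (links (insert n (B - {t})))\<^sup>*"
  shows "grid_connected (insert n (B - {t}))"
proof (rule connected_if_all_linked)
  fix p assume p: "p \<in> insert n (B - {t})"
  show "(p, n) \<in> (links (insert n (B - {t})))\<^sup>*"
  proof (cases "p = n")
    case False
    with p have "p \<in> B" "p \<noteq> t" by auto
    then have "(p, t) \<in> (links B)\<^sup>*"
      using conn t by (auto simp: grid_connected_def)
    then show ?thesis
      using \<open>p \<noteq> t\<close>
    proof (induction rule: converse_rtrancl_induct)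
      case (step u v)
      show ?case
      proof (cases "v = t")
        case True
        with step nb show ?thesis by auto
      next
        case False
        with step have "(u, v) \<in> links (insert n (B - {t}))" by auto
        with step False show ?thesis
          by (auto intro: converse_rtrancl_into_rtrancl)
      qed
    qed simp
  qed simp
qed

section \<open>Distances in connected fields\<close>

lemma manhattan_adjacent: "adjacent u v \<Longrightarrow> manhattan p v \<le> Suc (manhattan p u)"
  by (cases p; cases u; cases v) (auto simp: manhattan_def adjacent_iff)

text \<open>A discrete intermediate value theorem: the distance from \<open>p\<close> changes by at
  most 1 along a link, so without a cell at distance \<open>k\<close> the cells closer than
  \<open>k\<close> would be closed under links.\<close>

lemma connected_distance:
  assumes conn: "grid_connected B" and p: "p \<in> B" and "q \<in> B" and "k \<le> manhattan p q"
  obtains r where "r \<in> B" "manhattan p r = k"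
proof (rule ccontr)
  assume "\<not> thesis"
  then have no: "\<And>r. r \<in> B \<Longrightarrow> manhattan p r \<noteq> k"
    using that by blast
  have "manhattan p p = 0" by (simp add: manhattan_def)
  with no[OF p] have "manhattan p p < k" by simp
  have "B \<subseteq> {r. manhattan p r < k}"
  proof (rule connected_closed[OF conn p])
    fix u v assume "u \<in> {r. manhattan p r < k}" "v \<in> B" "adjacent u v"
    then show "v \<in> {r. manhattan p r < k}"
      using manhattan_adjacent[of u v p] no[of v] by simp
  qed (use \<open>manhattan p p < k\<close> in simp)
  with assms(3,4) show False by auto
qed

text \<open>Every distance from 0 to \<open>manhattan p q\<close> is attained in
  \<open>B\<close>.\<close>

lemma card_ge_distance:
  assumes "grid_connected B" "finite B" "p \<in> B" "q \<in> B"
  shows "manhattan p q < card B"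
proof -
  have "{..manhattan p q} \<subseteq> manhattan p ` B"
    by (auto elim: connected_distance[OF assms(1,3,4)])
  then have "card {..manhattan p q} \<le> card B"
    using assms(2) by (rule surj_card_le[rotated])
  then show ?thesis by simp
qed

lemma field_span_le_iff:
  assumes "finite B" "B \<noteq> {}"
  shows "field_span B \<le> k \<longleftrightarrow> (\<forall>p\<in>B. \<forall>q\<in>B. manhattan p q \<le> k)"
proof -
  have "field_span B = Max ((\<lambda>(p, q). manhattan p q) ` (B \<times> B))"
    unfolding field_span_def by (rule arg_cong[where f = Max]) auto
  with assms show ?thesis by auto
qed

section \<open>Probing the surroundings\<close>

definition shift :: "cell \<Rightarrow> cell \<Rightarrow> cell" where
  "shift s p = (fst s + fst p, snd s + snd p)"

lemma neighbour_shift: "neighbour d (shift s p) = shift s (neighbour d p)"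
  by (cases s; cases p; cases d) (auto simp: shift_def)

lemma trace_shift: "trace (shift s p) ds = map (shift s) (trace p ds)"
  by (induction ds arbitrary: p) (auto simp: neighbour_shift)

lemma length_trace [simp]: "length (trace p ds) = length ds"
  by (induction ds arbitrary: p) auto

lemma trace_append: "trace p (ds @ es) = trace p ds @ trace (fold neighbour ds p) es"
  by (induction ds arbitrary: p) auto

lemma manhattan_shift [simp]: "manhattan (shift s p) (shift s q) = manhattan p q"
  by (simp add: manhattan_def shift_def)

lemma fold_neighbour_shift: "fold neighbour ds (shift s p) = shift s (fold neighbour ds p)"
  by (induction ds arbitrary: p) (auto simp: neighbour_shift)

text \<open>Moves commute with translations, so it is enough to compute the walk from the
  origin.\<close>

lemma tour_closed: "fold neighbour tour s = s"
proof -
  have "fold neighbour tour (shift s (0, 0)) = shift s (0, 0)"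
    unfolding fold_neighbour_shift by (simp add: tour_def numeral_eq_Suc)
  then show ?thesis by (simp add: shift_def)
qed

lemma tour_covers:
  assumes "\<bar>a\<bar> \<le> 3" "\<bar>b\<bar> \<le> 3"
  shows "(a, b) \<in> set (trace (0, 0) tour)"
proof -
  have "a \<in> {-3, -2, -1, 0, 1, 2, 3}" "b \<in> {-3, -2, -1, 0, 1, 2, 3}"
    using assms by auto
  moreover have "\<forall>a\<in>{-3, -2, -1, 0, 1, 2, 3}. \<forall>b\<in>{-3, -2, -1, 0, 1, 2, 3}.
      (a, b) \<in> set (trace (0, 0) tour)"
    by (simp add: tour_def eval_nat_numeral)
  ultimately show ?thesis by blast
qed

lemma tour_covers_ball:
  assumes "manhattan s p \<le> 3"
  obtains r where "r \<in> set (trace (0, 0) tour)" "p = shift s r"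
proof
  show "p = shift s (fst p - fst s, snd p - snd s)"
    by (simp add: shift_def)
  show "(fst p - fst s, snd p - snd s) \<in> set (trace (0, 0) tour)"
    using assms by (intro tour_covers) (auto simp: manhattan_def)
qed

lemma narrow_iff:
  assumes "finite F" "grid_connected F" "s \<in> F"
  shows "narrow (map (\<lambda>p. p \<in> F) (trace s tour)) \<longleftrightarrow> field_span F \<le> 2"
proof -
  let ?T = "trace (0, 0) tour"
  have tr: "trace s tour = map (shift s) ?T"
    using trace_shift[of s "(0, 0)" tour] by (simp add: shift_def)
  have zip: "set (zip ?T (map (\<lambda>p. p \<in> F) (trace s tour))) = (\<lambda>p. (p, shift s p \<in> F)) ` set ?T"
    by (simp add: tr zip_map2 zip_same_conv_map comp_def)
  have narrow: "narrow (map (\<lambda>p. p \<in> F) (trace s tour)) \<longleftrightarrow>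
      (\<forall>p\<in>set ?T. \<forall>q\<in>set ?T. shift s p \<in> F \<and> shift s q \<in> F \<longrightarrow> manhattan p q \<le> 2)" (is "_ \<longleftrightarrow> ?N")
    unfolding narrow_def zip by simp
  have "?N \<longleftrightarrow> (\<forall>p\<in>F. \<forall>q\<in>F. manhattan p q \<le> 2)"
  proof
    assume N: ?N
    have near: "manhattan p q \<le> 2"
      if pq: "p \<in> F" "q \<in> F" "manhattan s p \<le> 3" "manhattan s q \<le> 3" for p q
    proof -
      obtain a b where "a \<in> set ?T" "p = shift s a" "b \<in> set ?T" "q = shift s b"
        using pq(3,4) tour_covers_ball by metis
      with N pq(1,2) show ?thesis by simp
    qed
    \<comment> \<open>The probed square thus contains the whole field: a brick farther away would
      force one at distance exactly 3 from \<open>s\<close>, which the probe would have seen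
      together with \<open>s\<close>.\<close>
    have "manhattan s p \<le> 3" if p: "p \<in> F" for p
    proof (rule ccontr)
      assume "\<not> manhattan s p \<le> 3"
      then obtain r where "r \<in> F" "manhattan s r = 3"
        using connected_distance[OF assms(2,3) p, of 3] by auto
      then show False
        using near[of s r] assms(3) by (simp add: manhattan_def)
    qed
    with near show "\<forall>p\<in>F. \<forall>q\<in>F. manhattan p q \<le> 2" by blast
  next
    assume "\<forall>p\<in>F. \<forall>q\<in>F. manhattan p q \<le> 2"
    then show ?N using manhattan_shift by metis
  qed
  then show ?thesis
    using narrow field_span_le_iff[OF assms(1), of 2] assms(3) by auto
qed

lemma run_builder: "run builder F s t = (step builder ^^ t) (cfg (Probe []) s False F)"
  by (simp add: run_def cfg_def builder_def)

lemma probing: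
  "t < length tour \<Longrightarrow> run builder F s t =
     cfg (Probe (map (\<lambda>p. p \<in> F) (trace s (take t tour)))) (fold neighbour (take t tour) s) False F"
proof (induction t)
  case (Suc t)
  then have "take (Suc t) tour = take t tour @ [tour ! t]"
    by (simp add: take_Suc_conv_app_nth)
  with Suc show ?case
    by (simp add: run_builder trace_append Let_def)
qed (simp add: run_builder)

lemma probed:
  assumes "finite F" "grid_connected F" "s \<in> F"
  shows "run builder F s (length tour) = cfg (if field_span F \<le> 2 then Done else Rise) s False F"
proof -
  define t where "t = length tour - 1"
  have t: "length tour = Suc t" "t < length tour"
    using tour_nonempty by (auto simp: t_def)
  have tour: "tour = take t tour @ [tour ! t]"
    using t by (metis take_Suc_conv_app_nth take_all order_refl)
  have all: "map (\<lambda>p. p \<in> F) (trace s (take t tour)) @ [fold neighbour (take t tour) s \<in> F] =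
      map (\<lambda>p. p \<in> F) (trace s tour)"
    \<comment> \<open>Only the occurrence of \<open>tour\<close> on the right-hand side is
      split.\<close>
    by (subst (3) tour) (simp add: trace_append)
  have "neighbour (tour ! t) (fold neighbour (take t tour) s) = s"
    using tour_closed[of s] by (subst (asm) tour) simp
  moreover have "run builder F s (Suc t) = step builder (run builder F s t)"
    by (simp add: run_builder)
  ultimately show ?thesis
    unfolding t(1) using probing[OF t(2), of F s] t all narrow_iff[OF assms]
    by (simp add: Let_def)
qed

section \<open>Collapsing the field to a vertical line\<close>

text \<open>The robot may start on an empty cell directly above a brick, as it does after a drop or
  after finding a western neighbour; then the segment ends just below.\<close>

lemma rise:
  assumes B: "finite B" and p: "(x, y) \<in> B \<or> (x, y - 1) \<in> B"
  obtains t where "(x, t) \<in> B" "(x, t + 1) \<notin> B"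
    "leads (cfg Rise (x, y) False B) (cfg (Scan False) (x, t) False B)"
proof -
  obtain t where t: "y \<le> t" "\<forall>i\<in>{y..<t}. (x, i) \<in> B" "(x, t) \<notin> B"
    using first_empty_above[OF B] .
  have top: "(x, t - 1) \<in> B"
    using p t by (cases "t = y") auto
  have "leads (cfg Rise (x, y) False B) (cfg Rise (x, t) False B)"
    using t by (intro leads_north) auto
  also have "leads \<dots> (cfg (Scan False) (x, t - 1) False B)"
    using t(3) by (intro leads_funpow[of 1]) simp
  finally show ?thesis
    using top t(3) by (intro that[of "t - 1"]) auto
qed

text \<open>Five steps: west, back, east, back, and down to the next row.\<close>

lemma scan_cell:
  assumes "(x, y) \<in> B" "(x - 1, y) \<notin> B"
  shows "leads (cfg (Scan e) (x, y) False B)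
    (cfg (Scan (e \<or> (x + 1, y) \<in> B)) (x, y - 1) False B)"
  using assms by (intro leads_funpow[of 5]) (simp add: eval_nat_numeral)

lemma scan:
  assumes "b \<le> t" "\<forall>i\<in>{b<..t}. (x, i) \<in> B \<and> (x - 1, i) \<notin> B"
  shows "leads (cfg (Scan False) (x, t) False B)
    (cfg (Scan (\<exists>i\<in>{b<..t}. (x + 1, i) \<in> B)) (x, b) False B)"
  using assms
proof (induction b rule: int_le_induct)
  case (step i)
  have split: "{i - 1<..t} = insert i {i<..t}"
    using step.hyps by auto
  have "leads (cfg (Scan False) (x, t) False B)
      (cfg (Scan (\<exists>j\<in>{i<..t}. (x + 1, j) \<in> B)) (x, i) False B)"
    using step by auto
  also have "leads \<dots> (cfg (Scan (\<exists>j\<in>{i - 1<..t}. (x + 1, j) \<in> B)) (x, i - 1) False B)"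
    using scan_cell[of x i B "\<exists>j\<in>{i<..t}. (x + 1, j) \<in> B"] step.prems step.hyps
    by (simp add: split disj_commute)
  finally show ?case .
qed simp

text \<open>The scan runs downwards, so it stops at the topmost row with a western neighbour; all
  rows above that one are handled by \<open>scan\<close>.\<close>

lemma scan_finds_west:
  assumes "b < t" "\<forall>i\<in>{b<..t}. (x, i) \<in> B" "\<exists>i\<in>{b<..t}. (x - 1, i) \<in> B"
  obtains i where "(x - 1, i) \<in> B"
    "leads (cfg (Scan False) (x, t) False B) (cfg Rise (x - 1, i + 1) False B)"
proof -
  have fin: "finite {i \<in> {b<..t}. (x - 1, i) \<in> B}"
    by (rule finite_subset[of _ "{b<..t}"]) auto
  define i where "i = Max {i \<in> {b<..t}. (x - 1, i) \<in> B}"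
  have "i \<in> {i \<in> {b<..t}. (x - 1, i) \<in> B}"
    unfolding i_def using assms(3) by (intro Max_in[OF fin]) auto
  then have i: "i \<in> {b<..t}" "(x - 1, i) \<in> B"
    by auto
  have "(x - 1, j) \<notin> B" if "j \<in> {i<..t}" for j
    using Max_ge[OF fin, of j] that i(1) unfolding i_def[symmetric] by auto
  then have "leads (cfg (Scan False) (x, t) False B)
      (cfg (Scan (\<exists>j\<in>{i<..t}. (x + 1, j) \<in> B)) (x, i) False B)"
    using assms(2) i(1) by (intro scan) auto
  also have "leads \<dots> (cfg Rise (x - 1, i + 1) False B)"
    using assms(2) i by (intro leads_funpow[of 2]) (simp add: eval_nat_numeral)
  finally show ?thesis
    using i(2) that by blast
qed

text \<open>Each western neighbour found takes the robot one column further west, which can happen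
  only finitely often because \<open>m\<close> bounds the field. A completed scan ends on the empty
  cell \<open>(u, b)\<close> and steps back up to the bottom brick.\<close>

lemma find_western_segment:
  assumes B: "finite B" and m: "\<forall>p\<in>B. m \<le> fst p"
  shows "(x, y) \<in> B \<or> (x, y - 1) \<in> B \<Longrightarrow>
    \<exists>u b t. b < t \<and> (\<forall>i\<in>{b<..t}. (u, i) \<in> B \<and> (u - 1, i) \<notin> B) \<and>
      (u, b) \<notin> B \<and> (u, t + 1) \<notin> B \<and>
      leads (cfg Rise (x, y) False B)
        (cfg (if \<exists>i\<in>{b<..t}. (u + 1, i) \<in> B then Climb else Stack) (u, b + 1) False B)"
proof (induction "nat (x - m)" arbitrary: x y rule: less_induct)
  case less
  obtain t where t: "(x, t) \<in> B" "(x, t + 1) \<notin> B"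
      "leads (cfg Rise (x, y) False B) (cfg (Scan False) (x, t) False B)"
    using rise[OF B less.prems] .
  obtain b where b: "b \<le> t" "\<forall>i\<in>{b<..t}. (x, i) \<in> B" "(x, b) \<notin> B"
    using first_empty_below[OF B] .
  then have "b < t"
    using t(1) by (cases "b = t") auto
  show ?case
  proof (cases "\<exists>i\<in>{b<..t}. (x - 1, i) \<in> B")
    case True
    then obtain i where i: "(x - 1, i) \<in> B"
        "leads (cfg (Scan False) (x, t) False B) (cfg Rise (x - 1, i + 1) False B)"
      using scan_finds_west[OF \<open>b < t\<close> b(2)] by blast
    have "nat (x - 1 - m) < nat (x - m)"
      using m i(1) by force
    moreover have "(x - 1, i + 1) \<in> B \<or> (x - 1, i + 1 - 1) \<in> B"
      using i(1) by simp
    ultimately show ?thesis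
      using less.hyps leads_trans[OF leads_trans[OF t(3) i(2)]] by blast
  next
    case False
    let ?e = "\<exists>i\<in>{b<..t}. (x + 1, i) \<in> B"
    note t(3)
    also have "leads (cfg (Scan False) (x, t) False B) (cfg (Scan ?e) (x, b) False B)"
      using b False by (intro scan) auto
    also have "leads \<dots> (cfg (if ?e then Climb else Stack) (x, b + 1) False B)"
      using b(3) by (intro leads_funpow[of 1]) simp
    finally show ?thesis
      using b False t(2) \<open>b < t\<close> by blast
  qed
qed

text \<open>\<open>Shift\<close> leaves row \<open>t\<close> before the search for an empty cell
  starts, so the brick lands strictly below its old row.\<close>

lemma move_top_east:
  assumes B: "finite B" and "b < t" and seg: "\<forall>i\<in>{b<..t}. (x, i) \<in> B"
    and top: "(x, t + 1) \<notin> B"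
  obtains n where "n < t" "\<forall>i\<in>{n<..<t}. (x + 1, i) \<in> B" "(x + 1, n) \<notin> B"
    "leads (cfg Climb (x, b + 1) False B)
      (cfg Rise (x + 1, n + 1) False (insert (x + 1, n) (B - {(x, t)})))"
proof -
  obtain n where n: "n \<le> t - 1" "\<forall>i\<in>{n<..t - 1}. (x + 1, i) \<in> B" "(x + 1, n) \<notin> B"
    using first_empty_below[OF B] .
  let ?B = "B - {(x, t)}"
  have "leads (cfg Climb (x, b + 1) False B) (cfg Climb (x, t + 1) False B)"
    using seg \<open>b < t\<close> by (intro leads_north) auto
  also have "leads \<dots> (cfg Sink (x + 1, t - 1) True ?B)"
    using top seg \<open>b < t\<close> by (intro leads_funpow[of 3]) (simp add: eval_nat_numeral pick_def)
  also have "leads \<dots> (cfg Sink (x + 1, n) True ?B)"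
    using n by (intro leads_south) auto
  also have "leads \<dots> (cfg Rise (x + 1, n + 1) False (insert (x + 1, n) ?B))"
    using n(3) by (intro leads_funpow[of 1]) (simp add: drop_brick_def)
  finally show ?thesis
    using n by (intro that[of n]) auto
qed

lemma links_column:
  assumes "a \<le> b" "\<forall>i\<in>{a..b}. (x, i) \<in> B"
  shows "((x, b), (x, a)) \<in> (links B)\<^sup>*"
  using assms
proof (induction b rule: int_ge_induct)
  case (step i)
  then have "((x, i + 1), (x, i)) \<in> links B"
    by (auto simp: adjacent_iff)
  moreover have "((x, i), (x, a)) \<in> (links B)\<^sup>*"
    using step by simp
  ultimately show ?case
    by (rule converse_rtrancl_into_rtrancl)
qed simp

text \<open>The removed brick can only have had neighbours below and to the east. The one below
  touches column \<open>x + 1\<close> in row \<open>t - 1\<close>, the eastern one lies on top of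
  that row; both are joined to the dropped brick by the full cells of column
  \<open>x + 1\<close>.\<close>

lemma connected_move_top_east:
  assumes "grid_connected B" "(x, t) \<in> B" "(x, t + 1) \<notin> B" "(x - 1, t) \<notin> B"
    and "n < t" "\<forall>i\<in>{n<..<t}. (x + 1, i) \<in> B"
  shows "grid_connected (insert (x + 1, n) (B - {(x, t)}))" (is "grid_connected ?B")
proof (rule connected_move_brick)
  fix p assume p: "p \<in> B" "p \<noteq> (x, t)" "adjacent p (x, t)"
  then consider "p = (x, t - 1)" | "p = (x + 1, t)"
    using assms(3,4) by (cases p) (auto simp: adjacent_iff)
  then show "(p, (x + 1, n)) \<in> (links ?B)\<^sup>*"
  proof cases
    case 1
    then have "(p, (x + 1, t - 1)) \<in> links ?B"
      using p assms(5,6) by (auto simp: adjacent_iff)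
    moreover have "((x + 1, t - 1), (x + 1, n)) \<in> (links ?B)\<^sup>*"
      using assms(5,6) by (intro links_column) auto
    ultimately show ?thesis
      by (rule converse_rtrancl_into_rtrancl)
  next
    case 2
    have "(x + 1, i) \<in> ?B" if "i \<in> {n..t}" for i
      using assms(6) p(1) 2 that by (cases "i = n"; cases "i = t") auto
    then have "((x + 1, t), (x + 1, n)) \<in> (links ?B)\<^sup>*"
      using assms(5) by (intro links_column) auto
    with 2 show ?thesis by simp
  qed
qed (use assms in auto)

text \<open>No link leaves the segment, so connectedness leaves room for nothing else.\<close>

lemma isolated_segment:
  assumes "grid_connected B" "b < t"
    and "\<forall>i\<in>{b<..t}. (x, i) \<in> B \<and> (x - 1, i) \<notin> B \<and> (x + 1, i) \<notin> B"
    and "(x, b) \<notin> B" "(x, t + 1) \<notin> B"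
  shows "B = {x} \<times> {b<..t}"
proof
  show "B \<subseteq> {x} \<times> {b<..t}"
  proof (rule connected_closed[of B "(x, t)"])
    fix u v assume uv: "u \<in> {x} \<times> {b<..t}" "v \<in> B" "adjacent u v"
    then obtain i where i: "u = (x, i)" "i \<in> {b<..t}" by auto
    then consider "v = (x, i + 1)" | "v = (x, i - 1)" | "v = (x + 1, i)" | "v = (x - 1, i)"
      using uv(3) by (cases v) (auto simp: adjacent_iff)
    then show "v \<in> {x} \<times> {b<..t}"
    proof cases
      case 1
      with uv(2) assms(5) have "i \<noteq> t" by auto
      with 1 i(2) show ?thesis by auto
    next
      case 2
      with uv(2) assms(4) have "i - 1 \<noteq> b" by auto
      with 2 i(2) show ?thesis by auto
    qed (use uv(2) assms(3) i(2) in auto)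
  qed (use assms in auto)
qed (use assms(3) in auto)

text \<open>\<open>M\<close> stays an upper bound for the first coordinates throughout, so the sum
  of the distances to column \<open>M\<close> is nonnegative; every brick moved east lowers it by
  1.\<close>

lemma collapse:
  "finite B \<Longrightarrow> grid_connected B \<Longrightarrow> (x, y) \<in> B \<or> (x, y - 1) \<in> B \<Longrightarrow> \<forall>p\<in>B. fst p \<le> M \<Longrightarrow>
    \<exists>u b. leads (cfg Rise (x, y) False B) (cfg Stack (u, b) False ({u} \<times> {b..<b + int (card B)}))"
proof (induction "nat (\<Sum>p\<in>B. M - fst p)" arbitrary: B x y rule: less_induct)
  case less
  note fin = less.prems(1)
  obtain m where "\<forall>p\<in>B. m \<le> fst p"
    using fin by (metis Min_le finite_imageI imageI)
  then obtain u b t where seg: "b < t" "\<forall>i\<in>{b<..t}. (u, i) \<in> B \<and> (u - 1, i) \<notin> B"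
      "(u, b) \<notin> B" "(u, t + 1) \<notin> B"
    and go: "leads (cfg Rise (x, y) False B)
        (cfg (if \<exists>i\<in>{b<..t}. (u + 1, i) \<in> B then Climb else Stack) (u, b + 1) False B)"
    using find_western_segment[OF fin _ less.prems(3)] by blast
  show ?case
  proof (cases "\<exists>i\<in>{b<..t}. (u + 1, i) \<in> B")
    case True
    obtain n where n: "n < t" "\<forall>i\<in>{n<..<t}. (u + 1, i) \<in> B" "(u + 1, n) \<notin> B"
        "leads (cfg Climb (u, b + 1) False B)
          (cfg Rise (u + 1, n + 1) False (insert (u + 1, n) (B - {(u, t)})))"
      using move_top_east[OF fin seg(1) _ seg(4)] seg(2) by blast
    let ?B = "insert (u + 1, n) (B - {(u, t)})"
    have t: "(u, t) \<in> B" "(u - 1, t) \<notin> B"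
      using seg by auto
    \<comment> \<open>The eastern neighbour already occupies column \<open>u + 1\<close>, so the
      moved brick respects the bound.\<close>
    have M: "u + 1 \<le> M"
      using True less.prems(4) by auto
    have "(\<Sum>p\<in>B. M - fst p) = (M - u) + (\<Sum>p\<in>B - {(u, t)}. M - fst p)"
      using fin t(1) by (simp add: sum.remove)
    moreover have "(\<Sum>p\<in>?B. M - fst p) = (M - (u + 1)) + (\<Sum>p\<in>B - {(u, t)}. M - fst p)"
      using fin n(3) by simp
    \<comment> \<open>Without this, \<open>nat\<close> could flatten the strict decrease of the
      integer sum.\<close>
    moreover have "0 \<le> (\<Sum>p\<in>B - {(u, t)}. M - fst p)"
      using less.prems(4) by (intro sum_nonneg) auto
    ultimately have "nat (\<Sum>p\<in>?B. M - fst p) < nat (\<Sum>p\<in>B. M - fst p)"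
      using M by simp
    moreover have "finite ?B"
      using fin by simp
    moreover have "grid_connected ?B"
      using connected_move_top_east[OF less.prems(2) t(1) seg(4) t(2) n(1,2)] .
    moreover have "(u + 1, n + 1) \<in> ?B \<or> (u + 1, n + 1 - 1) \<in> ?B"
      by simp
    moreover have "\<forall>p\<in>?B. fst p \<le> M"
      using less.prems(4) M by auto
    ultimately obtain v c where vc: "leads (cfg Rise (u + 1, n + 1) False ?B)
        (cfg Stack (v, c) False ({v} \<times> {c..<c + int (card ?B)}))"
      using less.hyps by meson
    have "leads (cfg Rise (x, y) False B) (cfg Rise (u + 1, n + 1) False ?B)"
      using leads_trans[OF _ n(4)] go True by simp
    note leads_trans[OF this vc]
    moreover have "card ?B = card B"
      using card_Suc_Diff1[OF fin t(1)] card_insert_disjoint[of "B - {(u, t)}" "(u + 1, n)"] fin n(3)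
      by simp
    ultimately show ?thesis by auto
  next
    case False
    have line: "B = {u} \<times> {b<..t}"
      using isolated_segment[OF less.prems(2) seg(1) _ seg(3,4)] seg(2) False by blast
    then have "{u} \<times> {b + 1..<b + 1 + int (card B)} = B"
      using seg(1) by (auto simp: card_cartesian_product)
    with go False show ?thesis
      by (intro exI[of _ u] exI[of _ "b + 1"]) simp
  qed
qed

section \<open>Folding a vertical line into a fort\<close>

definition column :: "int \<Rightarrow> int \<Rightarrow> int \<Rightarrow> cell set" where
  "column x y n = {x} \<times> {y..<y + n}"

lemma in_column [simp]: "(u, v) \<in> column x y n \<longleftrightarrow> u = x \<and> y \<le> v \<and> v < y + n"
  by (auto simp: column_def)

lemma card_column [simp]: "card (column x y n) = nat n"
  by (simp add: column_def card_cartesian_product)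

lemma finite_column [simp]: "finite (column x y n)"
  by (simp add: column_def)

text \<open>The intermediate shape: a U of width 3, open at the top, with arms of heights
  \<open>h\<close> and \<open>j\<close>; with \<open>j = 0\<close> the right arm is still
  missing.\<close>

definition folded :: "int \<Rightarrow> int \<Rightarrow> int \<Rightarrow> int \<Rightarrow> cell set" where
  "folded x y h j = insert (x + 1, y) (column x y h \<union> column (x + 2) y j)"

lemma in_folded:
  "(u, v) \<in> folded x y h j \<longleftrightarrow>
     u = x + 1 \<and> v = y \<or> u = x \<and> y \<le> v \<and> v < y + h \<or> u = x + 2 \<and> y \<le> v \<and> v < y + j"
  by (auto simp: folded_def)

text \<open>The way to the base cell passes below row \<open>y\<close>, so only the shape of column
  \<open>x\<close> matters and the lemma serves the first brick and all later ones.\<close>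

lemma carry_top_down:
  assumes "2 \<le> h" and col: "\<forall>i. (x, i) \<in> B \<longleftrightarrow> y \<le> i \<and> i < y + h" and i: "y \<le> i" "i \<le> y + h"
  shows "leads (cfg Stack (x, i) False B) (cfg Base (x + 1, y) True (B - {(x, y + h - 1)}))"
proof -
  let ?B = "B - {(x, y + h - 1)}"
  have "leads (cfg Stack (x, i) False B) (cfg Stack (x, y + h) False B)"
    using col i by (intro leads_north) auto
  also have "leads \<dots> (cfg Descend (x, y + h - 2) True ?B)"
    using col \<open>2 \<le> h\<close> by (intro leads_funpow[of 2]) (simp add: eval_nat_numeral pick_def)
  also have "leads \<dots> (cfg Descend (x, y - 1) True ?B)"
    using col \<open>2 \<le> h\<close> by (intro leads_south) auto
  also have "leads \<dots> (cfg Base (x + 1, y) True ?B)"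
    using col by (intro leads_funpow[of 2]) (simp add: eval_nat_numeral)
  finally show ?thesis .
qed

text \<open>The cell gauged in row \<open>y + 4\<close> is full exactly when \<open>h\<close> is at
  least 6; this separates the rectangle of width 2 from those of width 3.\<close>

lemma first_brick:
  assumes "2 \<le> h"
  shows "leads (cfg Stack (x, y) False (column x y h))
    (cfg (Gauge []) (x, y + 4) False (folded x y (h - 1) 0))"
proof -
  have eq: "insert (x + 1, y) (column x y h - {(x, y + h - 1)}) = folded x y (h - 1) 0"
    using assms by (auto simp: folded_def)
  have "leads (cfg Stack (x, y) False (column x y h))
      (cfg Base (x + 1, y) True (column x y h - {(x, y + h - 1)}))"
    using assms by (intro carry_top_down) auto
  also have "leads \<dots> (cfg (Gauge []) (x, y + 4) False (folded x y (h - 1) 0))"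
    by (intro leads_funpow[of 5]) (simp add: eval_nat_numeral drop_brick_def eq, simp add: algebra_simps)
  finally show ?thesis .
qed

text \<open>The walk ends in the left column three rows above the new brick; that cell is full
  exactly when the left arm still exceeds the right one by at least 3.\<close>

lemma next_brick:
  assumes "2 \<le> h" "0 \<le> j" "y \<le> i" "i \<le> y + h"
  shows "leads (cfg Stack (x, i) False (folded x y h j))
    (cfg (Gauge []) (x, y + j + 3) False (folded x y (h - 1) (j + 1)))"
proof -
  let ?B = "folded x y h j - {(x, y + h - 1)}"
  have eq: "insert (x + 2, y + j) ?B = folded x y (h - 1) (j + 1)"
    using assms by (auto simp: folded_def)
  have "leads (cfg Stack (x, i) False (folded x y h j)) (cfg Base (x + 1, y) True ?B)"
    using assms by (intro carry_top_down) (auto simp: in_folded)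
  also have "leads \<dots> (cfg Grow (x + 2, y) True ?B)"
    by (intro leads_funpow[of 1]) (simp add: in_folded algebra_simps)
  also have "leads \<dots> (cfg Grow (x + 2, y + j) True ?B)"
    using assms by (intro leads_north) (auto simp: in_folded)
  also have "leads \<dots> (cfg (Gauge []) (x, y + j + 3) False (folded x y (h - 1) (j + 1)))"
    using eq by (intro leads_funpow[of 5]) (simp add: eval_nat_numeral drop_brick_def in_folded algebra_simps)
  finally show ?thesis .
qed

text \<open>The gauged row \<open>y + k\<close> is empty and the top brick is one or two rows below
  it, found by \<open>Top\<close> or \<open>BelowTop\<close>. The longer list in
  \<open>Close\<close> makes up for the difference, so both cases drop in row
  \<open>y + k - 3\<close>.\<close>

lemma close_ring:
  assumes "3 \<le> k" "h = k \<or> h = k - 1" "(x + 1, y + k - 3) \<notin> folded x y h j"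
  shows "leads (cfg (Gauge []) (x, y + k) False (folded x y h j))
    (cfg Done (x + 1, y + k - 2) False (insert (x + 1, y + k - 3) (folded x y (h - 1) j)))"
proof -
  have eq: "folded x y h j - {(x, y + h - 1)} = folded x y (h - 1) j"
    using assms by (auto simp: folded_def)
  from assms(2) show ?thesis
  proof
    assume h: "h = k"
    have "leads (cfg (Gauge []) (x, y + k) False (folded x y h j))
        (cfg (Close [South, East]) (x, y + k - 2) True (folded x y (h - 1) j))"
      using assms(1) eq
      by (intro leads_funpow[of 2]) (simp add: eval_nat_numeral pick_def in_folded h)
    also have "leads \<dots>
        (cfg Done (x + 1, y + k - 2) False (insert (x + 1, y + k - 3) (folded x y (h - 1) j)))"
      using assms by (intro leads_funpow[of 3]) (simp add: eval_nat_numeral drop_brick_def in_folded algebra_simps)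
    finally show ?thesis .
  next
    assume h: "h = k - 1"
    have "leads (cfg (Gauge []) (x, y + k) False (folded x y h j))
        (cfg (Close [East]) (x, y + k - 3) True (folded x y (h - 1) j))"
      using assms(1) eq
      by (intro leads_funpow[of 3]) (simp add: eval_nat_numeral pick_def in_folded h)
    also have "leads \<dots>
        (cfg Done (x + 1, y + k - 2) False (insert (x + 1, y + k - 3) (folded x y (h - 1) j)))"
      using assms by (intro leads_funpow[of 2]) (simp add: eval_nat_numeral drop_brick_def in_folded algebra_simps)
    finally show ?thesis .
  qed
qed

section \<open>Recognising the final shapes as forts\<close>

lemma fort_perimeter:
  assumes "admissible_rectangle (card (perimeter x1 x2 y1 y2)) x1 x2 y1 y2"
    and "even (card (perimeter x1 x2 y1 y2))"
  shows "fort (perimeter x1 x2 y1 y2)"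
  using assms by (auto simp: fort_def smooth_fort_def)

lemma fort_insert_perimeter:
  assumes "admissible_rectangle (card (insert (x1, y2 + 1) (perimeter x1 x2 y1 y2))) x1 x2 y1 y2"
    and "odd (card (insert (x1, y2 + 1) (perimeter x1 x2 y1 y2)))"
  shows "fort (insert (x1, y2 + 1) (perimeter x1 x2 y1 y2))"
proof -
  have "adjacent (x1, y2) (x1, y2 + 1)" "(x1, y2 + 1) \<notin> perimeter x1 x2 y1 y2"
    by (auto simp: adjacent_iff perimeter_def)
  with assms have "rough_fort (insert (x1, y2 + 1) (perimeter x1 x2 y1 y2))"
    unfolding rough_fort_def by blast
  with assms(2) show ?thesis
    by (simp add: fort_def)
qed

lemma perimeter_width_2:
  assumes "2 \<le> n"
  shows "perimeter x (x + 1) y (y + n - 1) = column x y n \<union> column (x + 1) y n"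
  using assms by (auto simp: perimeter_def)

lemma perimeter_width_3:
  assumes "2 \<le> n"
  shows "perimeter x (x + 2) y (y + n - 1) =
    insert (x + 1, y + n - 1) (folded x y n n)"
  using assms by (auto simp: perimeter_def in_folded)

lemma card_perimeter_width_3:
  assumes "2 \<le> n"
  shows "card (perimeter x (x + 2) y (y + n - 1)) = nat (2 * n + 2)"
proof -
  have "card (column x y n \<union> column (x + 2) y n) = nat n + nat n"
    by (subst card_Un_disjoint) (auto simp: column_def)
  then show ?thesis
    using assms by (simp add: perimeter_width_3 in_folded) (simp add: folded_def)
qed

text \<open>The added brick closes the U in the top row of the right arm. If the left arm is one
  longer, its top brick is the extra one above the corner \<open>(x, y + j - 1)\<close>.\<close>

lemma fort_width_3:
  assumes "2 \<le> j" "h = j \<or> h = j + 1"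
  shows "fort (insert (x + 1, y + j - 1) (folded x y h j))"
  using assms(2)
proof
  assume "h = j"
  then have "insert (x + 1, y + j - 1) (folded x y h j) = perimeter x (x + 2) y (y + j - 1)"
    using assms(1) perimeter_width_3 by simp
  \<comment> \<open>Eight or more bricks force \<open>j\<close> to be at least 3, so the rectangle
    encloses a cell.\<close>
  moreover have "admissible_rectangle (nat (2 * j + 2)) x (x + 2) y (y + j - 1)"
    using assms(1) by (auto simp: admissible_rectangle_def)
  moreover have "even (nat (2 * j + 2))"
    using assms(1) by (simp add: even_nat_iff)
  ultimately show ?thesis
    using assms(1) card_perimeter_width_3 fort_perimeter by simp
next
  assume h: "h = j + 1"
  have eq: "insert (x + 1, y + j - 1) (folded x y h j) =
      insert (x, y + j - 1 + 1) (perimeter x (x + 2) y (y + j - 1))"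
    using assms(1) h by (auto simp: perimeter_width_3 in_folded)
  have "finite (perimeter x (x + 2) y (y + j - 1))"
    using assms(1) by (simp add: perimeter_width_3 folded_def)
  moreover have "(x, y + j - 1 + 1) \<notin> perimeter x (x + 2) y (y + j - 1)"
    by (simp add: perimeter_def)
  ultimately have "card (insert (x, y + j - 1 + 1) (perimeter x (x + 2) y (y + j - 1))) = nat (2 * j + 3)"
    using assms(1) by (simp add: card_perimeter_width_3)
  moreover have "admissible_rectangle (nat (2 * j + 3)) x (x + 2) y (y + j - 1)"
    using assms(1) by (auto simp: admissible_rectangle_def)
  moreover have "odd (nat (2 * j + 3))"
    using assms(1) by (simp add: even_nat_iff)
  ultimately show ?thesis
    unfolding eq by (intro fort_insert_perimeter) simp_all
qed

text \<open>Here the base cell \<open>(x + 1, y)\<close> serves as the bottom of the second column.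
  With four or five bricks no enclosed cell is demanded.\<close>

lemma fort_width_2:
  assumes "h = 2 \<or> h = 3"
  shows "fort (insert (x + 1, y + 1) (folded x y h 0))"
proof -
  let ?P = "perimeter x (x + 1) y (y + 1)"
  have P: "?P = column x y 2 \<union> column (x + 1) y 2"
    using perimeter_width_2[of 2 x y] by (simp add: algebra_simps)
  have card: "card ?P = 4"
    unfolding P by (subst card_Un_disjoint) (auto simp: column_def)
  show ?thesis
    using assms
  proof
    assume "h = 2"
    then have eq: "insert (x + 1, y + 1) (folded x y h 0) = ?P"
      by (auto simp: P in_folded)
    show ?thesis
      unfolding eq by (intro fort_perimeter) (simp_all add: card admissible_rectangle_def)
  next
    assume "h = 3"
    then have eq: "insert (x + 1, y + 1) (folded x y h 0) = insert (x, y + 1 + 1) ?P"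
      by (auto simp: P in_folded)
    have "(x, y + 1 + 1) \<notin> ?P"
      by (simp add: perimeter_def)
    then have "card (insert (x, y + 1 + 1) ?P) = 5"
      using card by (simp add: P)
    then show ?thesis
      unfolding eq by (intro fort_insert_perimeter) (simp_all add: admissible_rectangle_def)
  qed
qed

text \<open>The left arm exceeds the right one by at least 3, and each round lowers the difference
  by 2. The bound 5 for \<open>j = 0\<close> ensures that the ring is never closed while the right
  arm has height 1.\<close>

lemma fold_line:
  "0 \<le> j \<Longrightarrow> j + 3 \<le> h \<Longrightarrow> j = 0 \<longrightarrow> 5 \<le> h \<Longrightarrow> y \<le> i \<Longrightarrow> i \<le> y + h \<Longrightarrow>
    \<exists>p B. fort B \<and> leads (cfg Stack (x, i) False (folded x y h j)) (cfg Done p False B)"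
proof (induction "nat h" arbitrary: h j i rule: less_induct)
  case less
  let ?B = "folded x y (h - 1) (j + 1)"
  have nb: "leads (cfg Stack (x, i) False (folded x y h j)) (cfg (Gauge []) (x, y + j + 3) False ?B)"
    using less.prems by (intro next_brick) auto
  show ?case
  proof (cases "j + 4 < h")
    case True
    have "leads (cfg (Gauge []) (x, y + j + 3) False ?B) (cfg Stack (x, y + j + 4) False ?B)"
      using True less.prems(1)
      by (intro leads_funpow[of 1]) (simp add: in_folded algebra_simps)
    note leads_trans[OF nb this]
    moreover obtain p B where "fort B" "leads (cfg Stack (x, y + j + 4) False ?B) (cfg Done p False B)"
      using less.hyps[of "h - 1" "j + 1" "y + j + 4"] True less.prems(1) by auto
    ultimately show ?thesis
      using leads_trans by blast
  next
    case False
    let ?C = "insert (x + 1, y + (j + 1) - 1) (folded x y (h - 2) (j + 1))"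
    \<comment> \<open>Here \<open>h\<close> is \<open>j + 3\<close> or \<open>j + 4\<close>, which
      excludes \<open>j = 0\<close>; so the cell in row \<open>y + j\<close> of the middle column
      lies above the base brick and is empty.\<close>
    have "leads (cfg (Gauge []) (x, y + (j + 3)) False ?B)
        (cfg Done (x + 1, y + (j + 3) - 2) False
          (insert (x + 1, y + (j + 3) - 3) (folded x y (h - 1 - 1) (j + 1))))"
      using False less.prems by (intro close_ring) (auto simp: in_folded)
    then have "leads (cfg (Gauge []) (x, y + j + 3) False ?B)
        (cfg Done (x + 1, y + (j + 3) - 2) False ?C)"
      by (simp add: algebra_simps)
    moreover have "fort ?C"
      using False less.prems by (intro fort_width_3) auto
    ultimately show ?thesis
      using leads_trans[OF nb] by blast
  qed
qed

lemma build_from_line: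
  assumes "4 \<le> n"
  shows "\<exists>p B. fort B \<and> leads (cfg Stack (x, y) False (column x y n)) (cfg Done p False B)"
proof (cases "n \<le> 5")
  \<comment> \<open>The left column has 3 or 4 bricks after the first move, so the gauged row
    \<open>y + 4\<close> is empty and the ring closes with \<open>k = 4\<close>.\<close>
  case True
  let ?C = "insert (x + 1, y + 1) (folded x y (n - 2) 0)"
  have "leads (cfg Stack (x, y) False (column x y n))
      (cfg (Gauge []) (x, y + 4) False (folded x y (n - 1) 0))"
    using assms by (intro first_brick) simp
  also have "leads \<dots> (cfg Done (x + 1, y + 4 - 2) False
      (insert (x + 1, y + 4 - 3) (folded x y (n - 1 - 1) 0)))"
    using assms True by (intro close_ring) (auto simp: in_folded)
  also have "insert (x + 1, y + 4 - 3) (folded x y (n - 1 - 1) 0) = ?C"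
    by (simp add: algebra_simps)
  finally have "leads (cfg Stack (x, y) False (column x y n)) (cfg Done (x + 1, y + 4 - 2) False ?C)" .
  moreover have "fort ?C"
    using assms True by (intro fort_width_2) auto
  ultimately show ?thesis by blast
next
  case False
  let ?B = "folded x y (n - 1) 0"
  have "leads (cfg Stack (x, y) False (column x y n)) (cfg (Gauge []) (x, y + 4) False ?B)"
    using assms by (intro first_brick) simp
  also have "leads \<dots> (cfg Stack (x, y + 5) False ?B)"
    using False by (intro leads_funpow[of 1]) (simp add: in_folded algebra_simps)
  finally have "leads (cfg Stack (x, y) False (column x y n)) (cfg Stack (x, y + 5) False ?B)" .
  moreover obtain p B where "fort B" "leads (cfg Stack (x, y + 5) False ?B) (cfg Done p False B)"
    using fold_line[of 0 "n - 1" y "y + 5" x] False by auto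
  ultimately show ?thesis
    using leads_trans by blast
qed

section \<open>The automaton builds a fort\<close>

lemma state_cfg_final [simp]: "state (cfg q p l B) \<in> final_states builder \<longleftrightarrow> q = Done"
  by (simp add: cfg_def builder_def)

lemma carrying_cfg [simp]: "carrying (cfg q p l B) = l"
  by (simp add: cfg_def)

lemma bricks_cfg [simp]: "bricks (cfg q p l B) = B"
  by (simp add: cfg_def)

lemma run_add: "run builder F s (t + u) = (step builder ^^ u) (run builder F s t)"
  by (simp add: run_builder add.commute[of t] funpow_add)

text \<open>Probing touches no brick, and \<open>Done\<close> is never left.\<close>

lemma run_small_field:
  assumes "finite F" "grid_connected F" "s \<in> F" "field_span F \<le> 2"
  shows "bricks (run builder F s t) = F"
proof (cases "t < length tour")
  case True
  then show ?thesis by (simp add: probing)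
next
  case False
  then obtain u where t: "t = length tour + u"
    using le_Suc_ex not_less by blast
  have "(step builder ^^ u) (cfg Done s False F) = cfg Done s False F"
    by (induction u) auto
  then show ?thesis
    using probed[OF assms(1-3)] assms(4) by (simp add: t run_add)
qed

lemma builds_fort:
  assumes F: "finite F" "grid_connected F" "s \<in> F" and span: "\<not> field_span F \<le> 2"
  shows "\<exists>t p B. fort B \<and> run builder F s t = cfg Done p False B"
proof -
  obtain p q where pq: "p \<in> F" "q \<in> F" "2 < manhattan p q"
    using span field_span_le_iff[OF F(1), of 2] F(3) by (metis empty_iff not_le)
  \<comment> \<open>Two bricks at distance at least 3 need at least 4 bricks in a connected
    field.\<close>
  have n: "4 \<le> int (card F)"
    using card_ge_distance[OF F(2,1) pq(1,2)] pq(3) by simp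
  have "\<forall>p\<in>F. fst p \<le> Max (fst ` F)"
    using F(1) by simp
  then obtain x y where
    line: "leads (cfg Rise s False F) (cfg Stack (x, y) False (column x y (int (card F))))"
    using collapse[OF F(1,2), of "fst s" "snd s" "Max (fst ` F)"] F(3)
    by (auto simp: column_def)
  obtain p B where B: "fort B"
    and fold: "leads (cfg Stack (x, y) False (column x y (int (card F)))) (cfg Done p False B)"
    using build_from_line[OF n] by blast
  obtain u where "(step builder ^^ u) (cfg Rise s False F) = cfg Done p False B"
    using leads_trans[OF line fold] by (auto simp: leads_def)
  then have "run builder F s (length tour + u) = cfg Done p False B"
    using span probed[OF F] by (simp add: run_add)
  with B show ?thesis by blast
qed

theorem theorem2:
  "\<exists>R. finite_automaton R \<and>
     (\<forall>F s. finite F \<and> grid_connected F \<and> s \<in> F \<longrightarrow>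
        (\<exists>T. state (run R F s T) \<in> final_states R \<and> \<not> carrying (run R F s T) \<and>
           (if field_span F \<le> 2 then \<forall>t. bricks (run R F s t) = F
            else fort (bricks (run R F s T)))))"
proof (intro exI[of _ builder] conjI allI impI)
  fix F s
  assume "finite F \<and> grid_connected F \<and> s \<in> F"
  then have F: "finite F" "grid_connected F" "s \<in> F"
    by auto
  show "\<exists>T. state (run builder F s T) \<in> final_states builder \<and> \<not> carrying (run builder F s T) \<and>
      (if field_span F \<le> 2 then \<forall>t. bricks (run builder F s t) = F
       else fort (bricks (run builder F s T)))"
  proof (cases "field_span F \<le> 2")
    case True
    then show ?thesis
      using probed[OF F] run_small_field[OF F True] by (intro exI[of _ "length tour"]) simp
  next
    case False
    then obtain t p B where "fort B" "run builder F s t = cfg Done p False B"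
      using builds_fort[OF F] by blast
    with False show ?thesis by (intro exI[of _ t]) simp
  qed
qed (rule finite_automaton_builder)

end
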